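(* Let $\mathcal A,\mathcal E$ be finite sets, $\mathsf M$ a positive integer, $\varepsilon>0$, and $P_{A,E}$ a (nonzero) sub-distribution on $\mathcal A\times\mathcal E$. Then for every $c>1$, $$2\bigl(1-\tfrac1c\bigr)\min_{Q_E}\min_{R'}\Bigl[P_{A,E}\Bigl\{(a,e):\frac{P_{A,E}(a,e)}{Q_E(e)}>c\,e^{-R'}\Bigr\}+\sqrt\varepsilon\,\mathsf M^{1/2}e^{-\frac12R'}\Bigr]\le\Delta_{d,\min}(\mathsf M,\varepsilon|P_{A,E})$$ $$\le\min_{Q_E}\min_{R'}\Bigl[2P_{A,E}\Bigl\{(a,e):\frac{P_{A,E}(a,e)}{Q_E(e)}>e^{-R'}\Bigr\}+\sqrt\varepsilon\,\mathsf M^{1/2}e^{-\frac12R'}\Bigr],$$ and $$\bigl(1-\tfrac1c\bigr)\min_{R'}\Bigl[\eta\bigl(P_{A,E}\{(a,e):P_{A|E}(a|e)\ge c\,e^{-R'}\},\log\mathsf M\bigr)+\varepsilon\mathsf M e^{-R'}\Bigr]\le\Delta_{I,\min}(\mathsf M,\varepsilon|P_{A,E})$$ $$\le\min_{R'}\Bigl[\eta\bigl(P_{A,E}\{(a,e):P_{A|E}(a|e)>e^{-R'}\},\log\mathsf M\bigr)+\varepsilon\mathsf M e^{-R'}\Bigr].$$ Here $Q_E$ ranges over probability distributions on $\mathcal E$ and $R'$ over $\mathbb R$, and minima are understood as infima.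
   Context: Logarithms are natural. A sub-distribution is a nonnegative function with total sum $\le 1$; $P_E(e)=\sum_aP_{A,E}(a,e)$; $P_{E,\mathrm{normal}}(e)=P_E(e)/\sum_{e'}P_E(e')$; $P_{A|E}(a|e)=P_{A,E}(a,e)/P_{E,\mathrm{normal}}(e)$ (for normalized $P_{A,E}$ this is the usual conditional distribution); for a set $\Omega$, $P_{A,E}(\Omega)=\sum_{(a,e)\in\Omega}P_{A,E}(a,e)$; $\|\cdot\|_1$ is the sum of absolute values; $\eta(x,y)=xy-x\log x$. A condition $P_{A,E}(a,e)/Q_E(e)>t$ is read as $P_{A,E}(a,e)>t\,Q_E(e)$. $H_{\min}(A|E|P\|Q_E)=-\log\max_{(a,e):Q_E(e)>0}\frac{P(a,e)}{Q_E(e)}$, and the same formula is used with $P_E$ in place of $Q_E$. With outer minima understood as infima, $$\Delta_{d,\min}(\mathsf M,\varepsilon|P_{A,E})=\min_{Q_E}\min_{P'_{A,E}}\Bigl[2\|P_{A,E}-P'_{A,E}\|_1+\sqrt\varepsilon\,\mathsf M^{1/2}e^{-\frac12H_{\min}(A|E|P'_{A,E}\|Q_E)}\Bigr],$$ $$\Delta_{I,\min}(\mathsf M,\varepsilon|P_{A,E})=\min_{R\in\mathbb R}\Bigl[\eta\Bigl(\min_{P'_{A,E}:\,P'_E\le P_E,\ H_{\min}(A|E|P'_{A,E}\|P_E)\ge R}\|P_{A,E}-P'_{A,E}\|_1,\ \log\mathsf M\Bigr)+\varepsilon\mathsf M e^{-R}\Bigr],$$ where $Q_E$ ranges over probability distributions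 on $\mathcal E$ and $P'_{A,E}$ over sub-distributions on $\mathcal A\times\mathcal E$.
   Formalization: Two corrections: H_min is taken as −∞ if P(a,e)>0 for some e with Q_E(e)=0 (else the first lower bound fails); in the last upper bound εM e^{−R'} is divided by the total mass of P_{A,E} (the printed bound fails for mass <1, and is unchanged for mass 1). *)

theory Defs
  imports Complex_Main "HOL-Library.Extended_Real"
begin

definition sub_dists :: "('b::finite \<Rightarrow> real) set" where
  "sub_dists = {P. (\<forall>x. 0 \<le> P x) \<and> (\<Sum>x\<in>UNIV. P x) \<le> 1}"

definition prob_dists :: "('b::finite \<Rightarrow> real) set" where
  "prob_dists = {Q. (\<forall>x. 0 \<le> Q x) \<and> (\<Sum>x\<in>UNIV. Q x) = 1}"

definition marginal :: "('a::finite \<times> 'e::finite \<Rightarrow> real) \<Rightarrow> 'e \<Rightarrow> real" where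
  "marginal P e = (\<Sum>a\<in>UNIV. P (a, e))"

definition normal_marginal :: "('a::finite \<times> 'e::finite \<Rightarrow> real) \<Rightarrow> 'e \<Rightarrow> real" where
  "normal_marginal P e = marginal P e / (\<Sum>e'\<in>UNIV. marginal P e')"

definition cond :: "('a::finite \<times> 'e::finite \<Rightarrow> real) \<Rightarrow> 'a \<Rightarrow> 'e \<Rightarrow> real" where
  "cond P a e = P (a, e) / normal_marginal P e"

definition l1_dist :: "('b::finite \<Rightarrow> real) \<Rightarrow> ('b \<Rightarrow> real) \<Rightarrow> real" where
  "l1_dist P P' = (\<Sum>x\<in>UNIV. \<bar>P x - P' x\<bar>)"

text \<open>Note \<open>0 * ln 0 = 0\<close>.\<close>
definition eta :: "real \<Rightarrow> real \<Rightarrow> real" where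
  "eta x y = x * y - x * ln x"

text \<open>Only used for \<open>x \<ge> 0\<close>; the library has \<open>ln 0 = 0\<close>, hence the explicit
  \<open>- log 0 = \<infinity>\<close>.\<close>
definition neg_log :: "real \<Rightarrow> ereal" where
  "neg_log x = (if x = 0 then \<infinity> else ereal (- ln x))"

definition exp_ereal :: "ereal \<Rightarrow> ereal" where
  "exp_ereal x = (case x of ereal r \<Rightarrow> ereal (exp r) | PInfty \<Rightarrow> \<infinity> | MInfty \<Rightarrow> 0)"

text \<open>The quotient \<open>p / 0\<close> counts as \<open>\<infinity>\<close> for \<open>p > 0\<close>, so the value is \<open>-\<infinity>\<close> unless the
  support of \<open>P\<close> lies over that of \<open>Q\<close>; pairs with \<open>0 / 0\<close> are left out of the maximum.
  Without the first case the infimum over \<open>Q\<close> in \<open>\<Delta>_d_min\<close> would be \<open>0\<close> whenever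
  some \<open>Q\<close> vanishes on the whole support of \<open>marginal P\<close>.\<close>
definition H_min :: "('a::finite \<times> 'e::finite \<Rightarrow> real) \<Rightarrow> ('e \<Rightarrow> real) \<Rightarrow> ereal" where
  "H_min P Q =
     (if \<exists>a e. Q e = 0 \<and> P (a, e) > 0 then -\<infinity>
      else neg_log (Max {P (a, e) / Q e | a e. Q e > 0}))"

definition \<Delta>_d_min :: "nat \<Rightarrow> real \<Rightarrow> ('a::finite \<times> 'e::finite \<Rightarrow> real) \<Rightarrow> ereal" where
  "\<Delta>_d_min M \<epsilon> P =
     (INF Q\<in>prob_dists. INF P'\<in>sub_dists.
        ereal (2 * l1_dist P P')
        + ereal (sqrt \<epsilon> * sqrt (real M)) * exp_ereal (- (ereal (1/2) * H_min P' Q)))"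

text \<open>The inner (real) infimum is over a nonempty set bounded below by \<open>0\<close>, since
  \<open>P' = 0\<close> is admissible for every \<open>R\<close>. The reference here is the unnormalized \<open>marginal P\<close>, whereas
  \<open>cond\<close> divides by the normalized one: \<open>P (a, e) / marginal P e = cond P a e / sum P UNIV\<close>.
  Hence the level \<open>exp (- R')\<close> for \<open>cond\<close> corresponds to \<open>exp (- R) = exp (- R') / sum P UNIV\<close>,
  and upper bounds by level sets of \<open>cond\<close> carry the factor \<open>1 / sum P UNIV\<close>; without it they
  fail for sub-normalized \<open>P\<close> (one point, \<open>P = 1/2\<close>, \<open>M = 2\<close>, \<open>\<epsilon> = 1/10\<close>).\<close>
definition \<Delta>_I_min :: "nat \<Rightarrow> real \<Rightarrow> ('a::finite \<times> 'e::finite \<Rightarrow> real) \<Rightarrow> ereal" where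
  "\<Delta>_I_min M \<epsilon> P =
     (INF R::real.
        ereal (eta (INF P'\<in>{P'\<in>sub_dists. (\<forall>e. marginal P' e \<le> marginal P e)
                                 \<and> H_min P' (marginal P) \<ge> ereal R}. l1_dist P P')
                   (ln (real M))
               + \<epsilon> * real M * exp (- R)))"

end

theory Submission
  imports Defs "HOL-Real_Asymp.Real_Asymp" "HOL-Analysis.Henstock_Kurzweil_Integration"
begin

text \<open>For a level \<open>K = exp (- R)\<close> and a reference \<open>q\<close>, the condition \<open>H_min P' q \<ge> R\<close> says
  \<open>P' \<le> K * q\<close>. Then \<open>P - P' \<ge> (1 - 1 / c) * P\<close> wherever \<open>P > c * K * q\<close>, which drives the lower
  bounds, while the upper bounds come from cutting \<open>P\<close> down to the level \<open>K\<close>.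
  For \<open>\<Delta>_I_min\<close> the optimal \<open>P'\<close> is \<open>min P (K * marginal P)\<close>, whose distance from \<open>P\<close> falls
  continuously from \<open>sum P UNIV\<close> to \<open>0\<close> as \<open>K\<close> grows. Since \<open>eta\<close> is concave but in general not monotone,
  \<open>eta d\<close> is compared with its values at both ends of an interval around \<open>d\<close>, the right
  end \<open>sum P UNIV\<close> being reached by the level sets as \<open>R' \<rightarrow> \<infinity>\<close>.\<close>

section \<open>Concavity properties of \<open>eta\<close>\<close>

text \<open>The right side exceeds the left by \<open>- k * x * ln k\<close>, which is nonnegative
  for \<open>k \<le> 1\<close>.\<close>

lemma eta_scale_ge:
  assumes "0 \<le> x" "0 < k" "k \<le> 1"
  shows "k * eta x y \<le> eta (k * x) y"
proof (cases "x = 0")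
  case False
  then have "ln (k * x) = ln k + ln x" using assms by (simp add: ln_mult)
  moreover have "k * x * ln k \<le> 0"
    using assms by (intro mult_nonneg_nonpos) auto
  ultimately show ?thesis by (simp add: eta_def algebra_simps)
qed (simp add: eta_def)

text \<open>Concavity in tangent form: \<open>y - ln d - 1\<close> is the derivative of
  \<open>eta\<close> in its first argument at \<open>d\<close>. For \<open>b > 0\<close> the claim
  is \<open>ln z \<le> z - 1\<close> at \<open>z = d / b\<close>, scaled by
  \<open>b\<close>.\<close>

lemma eta_tangent:
  assumes "0 < d" "0 \<le> b"
  shows "eta b y \<le> eta d y + (y - ln d - 1) * (b - d)"
proof (cases "b = 0")
  case False
  then have b: "0 < b" using assms by simp
  have "ln (d / b) \<le> d / b - 1" using b assms by (intro ln_le_minus_one) simp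
  then have "b * ln (d / b) \<le> b * (d / b - 1)" using b by (intro mult_left_mono) auto
  also have "\<dots> = d - b" using b by (simp add: field_simps)
  finally have "b * (ln d - ln b) \<le> d - b" using b assms by (simp add: ln_div)
  then show ?thesis by (simp add: eta_def algebra_simps)
qed (simp add: eta_def algebra_simps assms less_imp_le)

text \<open>The tangent at \<open>d\<close> lies above \<open>eta\<close>, and the sign of its slope
  decides which end of the interval lies below the value at \<open>d\<close>.\<close>

lemma eta_quasiconcave:
  assumes "0 \<le> a" "a \<le> d" "d \<le> b"
  shows "eta a y \<le> eta d y \<or> eta b y \<le> eta d y"
proof (cases "d = 0")
  case False
  then have d: "0 < d" using assms by simp
  show ?thesis
  proof (cases "0 \<le> y - ln d - 1")
    case True
    then have "(y - ln d - 1) * (a - d) \<le> 0" using assms by (intro mult_nonneg_nonpos) auto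
    with eta_tangent[OF d assms(1), of y] show ?thesis by linarith
  next
    case False
    then have "(y - ln d - 1) * (b - d) \<le> 0" using assms by (intro mult_nonpos_nonneg) auto
    moreover have "eta b y \<le> eta d y + (y - ln d - 1) * (b - d)"
      using assms d by (intro eta_tangent) auto
    ultimately show ?thesis by linarith
  qed
qed (use assms in auto)

lemma eta_nonneg:
  assumes "0 \<le> x" "x \<le> 1" "0 \<le> y"
  shows "0 \<le> eta x y"
proof (cases "x = 0")
  case False
  then have "ln x \<le> 0" using assms by simp
  then have "x * ln x \<le> 0" using assms by (intro mult_nonneg_nonpos) auto
  moreover have "0 \<le> x * y" using assms by simp
  ultimately show ?thesis by (simp add: eta_def)
qed (simp add: eta_def)

section \<open>Min-entropy bounds as pointwise bounds\<close>

lemma neg_log_ge_iff: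
  assumes "0 \<le> x"
  shows "ereal R \<le> neg_log x \<longleftrightarrow> x \<le> exp (- R)"
proof (cases "x = 0")
  case False
  then have "ln x \<le> - R \<longleftrightarrow> x \<le> exp (- R)"
    using assms ln_le_cancel_iff[of x "exp (- R)"] by simp
  then show ?thesis using False by (auto simp: neg_log_def)
qed (simp add: neg_log_def)

text \<open>Multiplying out the quotients in the maximum gives the bound where
  \<open>Q e > 0\<close>. Where \<open>Q e = 0\<close> the bound forces \<open>P (a, e) = 0\<close>,
  and its failure there is exactly the case of value \<open>-\<infinity>\<close>. The point
  \<open>e0\<close> keeps the maximum over a nonempty set.\<close>

lemma H_min_ge_iff:
  assumes P: "\<And>x. 0 \<le> P x" and Q: "\<And>e. 0 \<le> Q e" and ex: "0 < Q e0"
  shows "ereal R \<le> H_min P Q \<longleftrightarrow> (\<forall>a e. P (a, e) \<le> exp (- R) * Q e)"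
proof (cases "\<exists>a e. Q e = 0 \<and> P (a, e) > 0")
  case True
  then obtain a e where ae: "Q e = 0" "P (a, e) > 0" by blast
  then have "\<not> P (a, e) \<le> exp (- R) * Q e" by simp
  moreover have "H_min P Q = -\<infinity>" using True by (simp add: H_min_def)
  ultimately show ?thesis by auto
next
  case False
  let ?S = "{P (a, e) / Q e | a e. Q e > 0}"
  have "?S \<subseteq> range (\<lambda>(a, e). P (a, e) / Q e)" by auto
  then have fin: "finite ?S" by (rule finite_subset) simp
  have ne: "?S \<noteq> {}" using ex by blast
  have "Max ?S \<in> ?S" using fin ne by (rule Max_in)
  then obtain a e where "Max ?S = P (a, e) / Q e" by blast
  then have nn: "0 \<le> Max ?S" using P Q by simp
  have "ereal R \<le> neg_log (Max ?S) \<longleftrightarrow> Max ?S \<le> exp (- R)"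
    using nn by (rule neg_log_ge_iff)
  also have "\<dots> \<longleftrightarrow> (\<forall>a e. 0 < Q e \<longrightarrow> P (a, e) / Q e \<le> exp (- R))"
    using fin ne by (auto simp: Max_le_iff)
  also have "\<dots> \<longleftrightarrow> (\<forall>a e. 0 < Q e \<longrightarrow> P (a, e) \<le> exp (- R) * Q e)"
    by (auto simp: pos_divide_le_eq)
  also have "\<dots> \<longleftrightarrow> (\<forall>a e. P (a, e) \<le> exp (- R) * Q e)"
  proof -
    have "P (a, e) \<le> exp (- R) * Q e" if "Q e = 0" for a e
      using False that by (auto simp: not_less)
    moreover have "0 < Q e \<or> Q e = 0" for e using Q[of e] by auto
    ultimately show ?thesis by blast
  qed
  finally show ?thesis unfolding H_min_def if_not_P[OF False] .
qed

lemma exp_ereal_mono: "x \<le> y \<Longrightarrow> exp_ereal x \<le> exp_ereal y"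
  by (cases x; cases y) (auto simp: exp_ereal_def)

section \<open>Averaging over thresholds with weight \<open>1 / t^2\<close>\<close>

lemma has_integral_inverse_square:
  fixes c :: real
  assumes "1 \<le> c"
  shows "((\<lambda>t. k / t\<^sup>2) has_integral k * (1 - 1 / c)) {1..c}"
proof -
  have "((\<lambda>t. k / t\<^sup>2) has_integral (- k / c - - k / 1)) {1..c}"
    by (rule fundamental_theorem_of_calculus[OF assms])
      (auto intro!: derivative_eq_intros simp flip: has_real_derivative_iff_has_vector_derivative
        simp: power2_eq_square)
  then show ?thesis by (simp add: algebra_simps)
qed

lemma has_integral_sqrt_inverse_square:
  fixes c :: real
  assumes "1 \<le> c"
  shows "((\<lambda>t. sqrt t / t\<^sup>2) has_integral 2 * (1 - 1 / sqrt c)) {1..c}"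
proof -
  have "((\<lambda>t. sqrt t / t\<^sup>2) has_integral (- 2 / sqrt c - - 2 / sqrt 1)) {1..c}"
  proof (rule fundamental_theorem_of_calculus[OF assms])
    fix t :: real assume "t \<in> {1..c}"
    then have t: "0 < t" by auto
    then have "((\<lambda>t. - 2 / sqrt t) has_real_derivative inverse (sqrt t) / t) (at t within {1..c})"
      by (auto intro!: derivative_eq_intros simp: field_simps)
    also have "inverse (sqrt t) / t = sqrt t / t\<^sup>2"
      using t by (simp add: field_simps power2_eq_square)
    finally show "((\<lambda>t. - 2 / sqrt t) has_vector_derivative sqrt t / t\<^sup>2) (at t within {1..c})"
      by (simp add: has_real_derivative_iff_has_vector_derivative)
  qed
  then show ?thesis by (simp add: algebra_simps)
qed

text \<open>The threshold condition holds exactly on an interval \<open>[1, r]\<close>, or, if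
  \<open>p < q\<close>, nowhere. In the first case the integral is \<open>p * (1 - 1 / r)\<close>,
  and \<open>r \<le> p / q\<close> for \<open>q > 0\<close> bounds it by \<open>p - q\<close>, hence
  by \<open>p - p'\<close>.\<close>

lemma threshold_integral:
  fixes p q p' c :: real
  assumes "0 \<le> p" "0 \<le> q" "p' \<le> q" "1 < c"
  shows "\<exists>i \<le> \<bar>p - p'\<bar>. ((\<lambda>t. (if t * q \<le> p then p else 0) / t\<^sup>2) has_integral i) {1..c}"
proof (cases "p < q")
  case True
  have "(if t * q \<le> p then p else 0) / t\<^sup>2 = 0" if "t \<in> {1..c}" for t
  proof -
    have "1 * q \<le> t * q" using that assms by (intro mult_right_mono) auto
    then show ?thesis using True by auto
  qed
  then have "((\<lambda>t. (if t * q \<le> p then p else 0) / t\<^sup>2) has_integral 0) {1..c}"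
    by (subst has_integral_cong[where g = "\<lambda>_. 0"]) auto
  then show ?thesis by (intro exI[of _ 0]) auto
next
  case False
  \<comment> \<open>The last \<open>t\<close> in \<open>[1, c]\<close> with
    \<open>t * q \<le> p\<close>; the case split keeps \<open>q = 0\<close> out of the
    division.\<close>
  define r where "r = (if c * q \<le> p then c else p / q)"
  have q0: "\<not> c * q \<le> p \<Longrightarrow> 0 < q" using assms by (cases "q = 0") auto
  have r: "1 \<le> r" "r \<le> c" "p * (1 - 1 / r) \<le> p - q"
    using assms False q0 by (auto simp: r_def field_simps)
  have iff: "t * q \<le> p \<longleftrightarrow> t \<in> {1..r}" if "t \<in> {1..c}" for t
  proof (cases "c * q \<le> p")
    case True
    have "t * q \<le> c * q" using that assms by (intro mult_right_mono) auto
    then show ?thesis using True that by (auto simp: r_def)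
  next
    case False
    then show ?thesis using that q0 by (auto simp: r_def field_simps)
  qed
  have "((\<lambda>t. if t \<in> {1..r} then p / t\<^sup>2 else 0) has_integral p * (1 - 1 / r)) {1..c}"
    using has_integral_inverse_square[OF r(1), of p] r(2)
    by (subst has_integral_restrict) auto
  also have "?this \<longleftrightarrow> ((\<lambda>t. (if t * q \<le> p then p else 0) / t\<^sup>2) has_integral p * (1 - 1 / r)) {1..c}"
    using iff by (intro has_integral_cong) auto
  finally show ?thesis using r(3) assms by (intro exI[of _ "p * (1 - 1 / r)"]) auto
qed

text \<open>Using only the threshold \<open>t = c\<close> would give \<open>2 * (1 - 1 / c)\<close> in front of \<open>s\<close>,
  which exceeds \<open>1\<close> for \<open>c > 2\<close>. Averaging over \<open>t \<in> [1, c]\<close> with density proportional to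
  \<open>1 / t\<^sup>2\<close> turns it into \<open>4 * u * (1 - u) \<le> 1\<close> with \<open>u = 1 / sqrt c\<close>.\<close>
lemma threshold_average:
  fixes P P' q :: "'b::finite \<Rightarrow> real"
  assumes P: "\<And>x. 0 \<le> P x" and q: "\<And>x. 0 \<le> q x" "\<And>x. P' x \<le> q x"
    and c: "1 < c" and s: "0 \<le> s"
    and I: "\<And>t. t \<in> {1..c} \<Longrightarrow> I \<le> sum P {x. t * q x < P x} + s * sqrt (t / c)"
  shows "2 * (1 - 1 / c) * I \<le> 2 * l1_dist P P' + s"
proof -
  define g where "g x t = (if t * q x \<le> P x then P x else 0)" for x t
  have "\<exists>i. \<forall>x. i x \<le> \<bar>P x - P' x\<bar> \<and> ((\<lambda>t. g x t / t\<^sup>2) has_integral i x) {1..c}"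
    unfolding g_def using threshold_integral[OF P q c] by (intro choice) blast
  then obtain i where i: "\<And>x. i x \<le> \<bar>P x - P' x\<bar>"
    and gi: "\<And>x. ((\<lambda>t. g x t / t\<^sup>2) has_integral i x) {1..c}" by blast
  have int: "((\<lambda>t. (\<Sum>x\<in>UNIV. g x t / t\<^sup>2) + s / sqrt c * (sqrt t / t\<^sup>2)) has_integral
      (\<Sum>x\<in>UNIV. i x) + s / sqrt c * (2 * (1 - 1 / sqrt c))) {1..c}"
    using c by (intro has_integral_add has_integral_sum has_integral_mult_right
        has_integral_sqrt_inverse_square gi) auto
  have "I * (1 - 1 / c) \<le> (\<Sum>x\<in>UNIV. i x) + s / sqrt c * (2 * (1 - 1 / sqrt c))"
  proof (rule has_integral_le[OF has_integral_inverse_square[of c I] int])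
    fix t assume t: "t \<in> {1..c}"
    \<comment> \<open>Passing to the non-strict condition only adds mass and matches the integrand
      \<open>g\<close>.\<close>
    have "sum P {x. t * q x < P x} \<le> sum P {x. t * q x \<le> P x}"
      using P by (intro sum_mono2) auto
    also have "\<dots> = (\<Sum>x\<in>UNIV. g x t)"
      unfolding g_def by (simp add: sum.If_cases)
    finally have "I \<le> (\<Sum>x\<in>UNIV. g x t) + s * sqrt (t / c)" using I[OF t] by simp
    then have "I / t\<^sup>2 \<le> ((\<Sum>x\<in>UNIV. g x t) + s * sqrt (t / c)) / t\<^sup>2"
      by (intro divide_right_mono) auto
    also have "\<dots> = (\<Sum>x\<in>UNIV. g x t / t\<^sup>2) + s / sqrt c * (sqrt t / t\<^sup>2)"
      by (simp add: sum_divide_distrib add_divide_distrib real_sqrt_divide)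
    finally show "I / t\<^sup>2 \<le> (\<Sum>x\<in>UNIV. g x t / t\<^sup>2) + s / sqrt c * (sqrt t / t\<^sup>2)" .
  qed (use c in auto)
  also have "(\<Sum>x\<in>UNIV. i x) \<le> l1_dist P P'"
    unfolding l1_dist_def by (intro sum_mono i)
  finally have *: "I * (1 - 1 / c) \<le> l1_dist P P' + s / sqrt c * (2 * (1 - 1 / sqrt c))" by simp
  define u where "u = 1 / sqrt c"
  have "0 \<le> (2 * u - 1)\<^sup>2" by simp
  then have "4 * u * (1 - u) \<le> 1" by (simp add: power2_eq_square algebra_simps)
  then have "s * (4 * u * (1 - u)) \<le> s * 1" using s by (intro mult_left_mono) auto
  moreover have "s / sqrt c * (2 * (1 - 1 / sqrt c)) = s * u * (2 * (1 - u))"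
    by (simp add: u_def)
  then have "s / sqrt c * (2 * (1 - 1 / sqrt c)) = s * (4 * u * (1 - u)) / 2"
    by simp
  ultimately have "2 * (I * (1 - 1 / c)) \<le> 2 * l1_dist P P' + s" using * by linarith
  then show ?thesis by (simp only: mult_ac)
qed

section \<open>Distances, sub-distributions and marginals\<close>

lemma l1_dist_cutoff:
  assumes "\<And>x. 0 \<le> P x"
  shows "l1_dist P (\<lambda>x. if T x then 0 else P x) = sum P {x. T x}"
proof -
  have "l1_dist P (\<lambda>x. if T x then 0 else P x) = (\<Sum>x\<in>UNIV. if T x then P x else 0)"
    unfolding l1_dist_def using assms by (intro sum.cong) auto
  then show ?thesis by (simp add: sum.If_cases)
qed

lemma sub_dists_nonneg: "P \<in> sub_dists \<Longrightarrow> 0 \<le> P x"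
  unfolding sub_dists_def by blast

lemma sub_dists_le:
  assumes "P \<in> sub_dists" "\<And>x. 0 \<le> P' x" "\<And>x. P' x \<le> P x"
  shows "P' \<in> sub_dists"
  using assms sum_mono[of UNIV P' P] by (auto simp: sub_dists_def intro: order_trans)

lemma sum_marginal: "(\<Sum>e\<in>UNIV. marginal P e) = sum P UNIV"
proof -
  have "(\<Sum>e\<in>UNIV. marginal P e) = (\<Sum>x\<in>UNIV \<times> UNIV. P (snd x, fst x))"
    unfolding marginal_def by (simp add: sum.cartesian_product case_prod_beta)
  also have "\<dots> = sum P UNIV"
    by (rule sum.reindex_bij_witness[of _ "\<lambda>x. (snd x, fst x)" "\<lambda>x. (snd x, fst x)"]) auto
  finally show ?thesis .
qed

lemma le_marginal:
  assumes "\<And>x. 0 \<le> P x"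
  shows "P (a, e) \<le> marginal P e"
  unfolding marginal_def by (rule member_le_sum[of a UNIV "\<lambda>a. P (a, e)"]) (use assms in auto)

lemma cond_eq: "cond P a e = P (a, e) * sum P UNIV / marginal P e"
  by (simp add: cond_def normal_marginal_def sum_marginal)

lemma prob_dists_pos:
  assumes "Q \<in> prob_dists"
  obtains e where "0 < Q e"
proof -
  have "\<exists>e. 0 < Q e"
  proof (rule ccontr)
    assume "\<not> ?thesis"
    then have "(\<Sum>e\<in>UNIV. Q e) \<le> 0" by (intro sum_nonpos) (auto simp: not_less)
    then show False using assms by (simp add: prob_dists_def)
  qed
  then show thesis using that by blast
qed

section \<open>Bounds for \<open>\<Delta>_d_min\<close>\<close>

text \<open>For fixed \<open>Q\<close> and \<open>P'\<close>, the infimum on the left is at most its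
  bracket at every \<open>R'\<close>. A whole family of values \<open>R'\<close>, one for each
  threshold \<open>t\<close>, is fed into \<open>threshold_average\<close>.\<close>

lemma \<Delta>_d_min_ge:
  fixes P :: "'a::finite \<times> 'e::finite \<Rightarrow> real"
  assumes P: "P \<in> sub_dists" and s: "0 < sqrt \<epsilon> * sqrt (real M)" and c: "c > 1"
  shows "ereal (2 * (1 - 1 / c)) *
        (INF Q\<in>prob_dists. INF R'::real.
           ereal (sum P {(a, e). P (a, e) > c * exp (- R') * Q e}
                  + sqrt \<epsilon> * sqrt (real M) * exp (- (1/2) * R')))
      \<le> \<Delta>_d_min M \<epsilon> P"
proof -
  define s where "s = sqrt \<epsilon> * sqrt (real M)"
  define J where "J = (INF Q\<in>prob_dists. INF R'::real.
           ereal (sum P {(a, e). P (a, e) > c * exp (- R') * Q e} + s * exp (- (1/2) * R')))"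
  have s0: "0 < s" using s by (simp add: s_def)
  have P0: "\<And>x. 0 \<le> P x" using P by (rule sub_dists_nonneg)
  have J_le: "J \<le> ereal (sum P {(a, e). P (a, e) > c * exp (- R) * Q e} + s * exp (- (1/2) * R))"
    if "Q \<in> prob_dists" for Q R
    unfolding J_def using that by (intro INF_lower2[of Q] INF_lower) auto
  have "0 \<le> J"
    unfolding J_def using P0 s0 by (intro INF_greatest) (auto intro!: add_nonneg_nonneg sum_nonneg)
  have "ereal (2 * (1 - 1 / c)) * J \<le> ereal (2 * l1_dist P P') + ereal s * exp_ereal (- (ereal (1/2) * H_min P' Q))"
    if Q: "Q \<in> prob_dists" and P': "P' \<in> sub_dists" for Q P'
  proof -
    have Q0: "\<And>e. 0 \<le> Q e" using Q by (simp add: prob_dists_def)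
    have P'0: "\<And>x. 0 \<le> P' x" using P' by (rule sub_dists_nonneg)
    obtain e0 where e0: "0 < Q e0" using Q by (rule prob_dists_pos)
    obtain I where I: "J = ereal I"
      using \<open>0 \<le> J\<close> J_le[OF Q, of 0] by (cases J) auto
    \<comment> \<open>Stated for every real \<open>R\<close> below the min-entropy, so that an
      infinite min-entropy can be reached as a limit.\<close>
    have key: "2 * (1 - 1 / c) * I \<le> 2 * l1_dist P P' + s * exp (- (1/2) * R)"
      if R: "ereal R \<le> H_min P' Q" for R
    proof (rule threshold_average[where q = "\<lambda>x. exp (- R) * Q (snd x)"])
      show "P' x \<le> exp (- R) * Q (snd x)" for x
        using R H_min_ge_iff[of P' Q e0 R, OF P'0 Q0 e0] by (cases x) auto
      fix t assume t: "t \<in> {1..c}"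
      \<comment> \<open>Chosen so that \<open>c * exp (- R') = t * exp (- R)\<close>: the level set
        becomes the one at threshold \<open>t\<close>, and the exponential term gains the factor
        \<open>sqrt (t / c)\<close>.\<close>
      define R' where "R' = R - ln (t / c)"
      have tc: "0 < t / c" using t c by auto
      have e: "exp (- R') = t / c * exp (- R)"
        using tc by (simp add: R'_def exp_diff exp_minus field_simps)
      have "sqrt (exp (- R')) = sqrt (t / c) * sqrt (exp (- R))"
        unfolding e by (rule real_sqrt_mult)
      moreover have sq: "sqrt (exp (- y)) = exp (- (1/2) * y)" for y :: real
        by (rule real_sqrt_unique) (auto simp: power2_eq_square simp flip: exp_add)
      ultimately have e2: "exp (- (1/2) * R') = exp (- (1/2) * R) * sqrt (t / c)"
        by simp
      have "c * exp (- R') = t * exp (- R)" using c by (simp add: e)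
      then have "{(a, e). P (a, e) > c * exp (- R') * Q e} = {x. t * (exp (- R) * Q (snd x)) < P x}"
        by (auto simp: mult.assoc)
      then show "I \<le> sum P {x. t * (exp (- R) * Q (snd x)) < P x} + s * exp (- (1/2) * R) * sqrt (t / c)"
        using J_le[OF Q, of R'] e2 by (simp add: I mult.assoc)
    qed (use P0 Q0 c s0 in auto)
    show ?thesis
    proof (cases "H_min P' Q")
      case (real R)
      then show ?thesis using key[of R] by (simp add: I exp_ereal_def)
    next
      case PInf
      have "(\<lambda>n. exp (- (1/2) * real n)) \<longlonglongrightarrow> 0"
        by real_asymp
      then have "(\<lambda>n. 2 * l1_dist P P' + s * exp (- (1/2) * real n)) \<longlonglongrightarrow> 2 * l1_dist P P' + s * 0"
        by (intro tendsto_intros)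
      then have "2 * (1 - 1 / c) * I \<le> 2 * l1_dist P P' + s * 0"
        by (rule LIMSEQ_le_const) (use key PInf in auto)
      then show ?thesis using PInf by (simp add: I exp_ereal_def)
    next
      \<comment> \<open>The right side is infinite because the coefficient \<open>s\<close> is
        positive.\<close>
      case MInf
      then show ?thesis using s0 by (simp add: exp_ereal_def)
    qed
  qed
  then show ?thesis
    unfolding \<Delta>_d_min_def J_def s_def by (intro INF_greatest) auto
qed

lemma \<Delta>_d_min_le:
  fixes P :: "'a::finite \<times> 'e::finite \<Rightarrow> real"
  assumes P: "P \<in> sub_dists" and s: "0 < sqrt \<epsilon> * sqrt (real M)"
  shows "\<Delta>_d_min M \<epsilon> P
      \<le> (INF Q\<in>prob_dists. INF R'::real.
           ereal (2 * sum P {(a, e). P (a, e) > exp (- R') * Q e}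
                  + sqrt \<epsilon> * sqrt (real M) * exp (- (1/2) * R')))"
proof (intro INF_greatest)
  fix Q :: "'e \<Rightarrow> real" and R :: real assume Q: "Q \<in> prob_dists"
  have P0: "\<And>x. 0 \<le> P x" using P by (rule sub_dists_nonneg)
  have Q0: "\<And>e. 0 \<le> Q e" using Q by (simp add: prob_dists_def)
  obtain e0 where e0: "0 < Q e0" using Q by (rule prob_dists_pos)
  \<comment> \<open>Setting \<open>P\<close> to zero above the level, instead of lowering it to the
    level, makes the distance exactly the mass of the level set.\<close>
  define P' where "P' = (\<lambda>x. if P x > exp (- R) * Q (snd x) then 0 else P x)"
  have "P' \<in> sub_dists" using P0 by (intro sub_dists_le[OF P]) (auto simp: P'_def)
  have "l1_dist P P' = sum P {x. P x > exp (- R) * Q (snd x)}"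
    unfolding P'_def by (rule l1_dist_cutoff) (rule P0)
  also have "{x. P x > exp (- R) * Q (snd x)} = {(a, e). P (a, e) > exp (- R) * Q e}" by auto
  finally have d: "l1_dist P P' = sum P {(a, e). P (a, e) > exp (- R) * Q e}" .
  have "ereal R \<le> H_min P' Q"
    by (subst H_min_ge_iff[where ?e0.0 = e0]) (use P0 Q0 e0 in \<open>auto simp: P'_def\<close>)
  then have "exp_ereal (- (ereal (1/2) * H_min P' Q)) \<le> exp_ereal (- (ereal (1/2) * ereal R))"
    by (intro exp_ereal_mono) (cases "H_min P' Q", auto)
  also have "\<dots> = ereal (exp (- (1/2) * R))" by (simp add: exp_ereal_def)
  finally have "ereal (sqrt \<epsilon> * sqrt (real M)) * exp_ereal (- (ereal (1/2) * H_min P' Q))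
      \<le> ereal (sqrt \<epsilon> * sqrt (real M)) * ereal (exp (- (1/2) * R))"
    using s by (intro ereal_mult_left_mono) auto
  then have "ereal (2 * l1_dist P P')
        + ereal (sqrt \<epsilon> * sqrt (real M)) * exp_ereal (- (ereal (1/2) * H_min P' Q))
      \<le> ereal (2 * l1_dist P P') + ereal (sqrt \<epsilon> * sqrt (real M)) * ereal (exp (- (1/2) * R))"
    by (rule add_left_mono)
  also have "\<dots> = ereal (2 * sum P {(a, e). P (a, e) > exp (- R) * Q e}
                  + sqrt \<epsilon> * sqrt (real M) * exp (- (1/2) * R))" by (simp add: d)
  finally show "\<Delta>_d_min M \<epsilon> P \<le> ereal (2 * sum P {(a, e). P (a, e) > exp (- R) * Q e}
                  + sqrt \<epsilon> * sqrt (real M) * exp (- (1/2) * R))"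
    unfolding \<Delta>_d_min_def using Q \<open>P' \<in> sub_dists\<close> by (intro INF_lower2[of Q] INF_lower2[of P'])
qed

section \<open>Bounds for \<open>\<Delta>_I_min\<close>\<close>

text \<open>An admissible \<open>P'\<close> stays below the level, so each point where
  \<open>P\<close> exceeds it contributes at least the excess. The truncation \<open>T\<close>
  attains equality everywhere, and \<open>T \<le> P\<close> gives the constraint on the
  marginals.\<close>

lemma truncation_dist:
  fixes P :: "'a::finite \<times> 'e::finite \<Rightarrow> real"
  assumes P: "P \<in> sub_dists" and nz: "P x0 \<noteq> 0"
  shows "(INF P'\<in>{P'\<in>sub_dists. (\<forall>e. marginal P' e \<le> marginal P e)
                                 \<and> H_min P' (marginal P) \<ge> ereal R}. l1_dist P P')
      = (\<Sum>x\<in>UNIV. max (P x - exp (- R) * marginal P (snd x)) 0)" (is "Inf (_ ` ?A) = ?d")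
proof -
  have P0: "\<And>x. 0 \<le> P x" using P by (rule sub_dists_nonneg)
  have m0: "0 \<le> marginal P e" for e unfolding marginal_def by (intro sum_nonneg) (simp add: P0)
  have "0 < P (fst x0, snd x0)" using nz P0[of x0] by simp
  also have "\<dots> \<le> marginal P (snd x0)" by (rule le_marginal) (rule P0)
  finally have mpos: "0 < marginal P (snd x0)" .
  have H: "ereal R \<le> H_min P' (marginal P) \<longleftrightarrow> (\<forall>a e. P' (a, e) \<le> exp (- R) * marginal P e)"
    if "\<And>x. 0 \<le> P' x" for P'
    using that m0 mpos by (rule H_min_ge_iff)
  have lb: "?d \<le> l1_dist P P'" if "P' \<in> ?A" for P'
  proof -
    have "P' x \<le> exp (- R) * marginal P (snd x)" for x
      using that H[of P'] by (cases x) (auto simp: sub_dists_def)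
    then have "max (P x - exp (- R) * marginal P (snd x)) 0 \<le> \<bar>P x - P' x\<bar>" for x
      by (smt (verit))
    then show ?thesis unfolding l1_dist_def by (intro sum_mono)
  qed
  define T where "T = (\<lambda>x. min (P x) (exp (- R) * marginal P (snd x)))"
  have T0: "0 \<le> T x" for x using P0 m0 by (simp add: T_def)
  have "T \<in> sub_dists" by (rule sub_dists_le[OF P T0]) (simp add: T_def)
  moreover have "marginal T e \<le> marginal P e" for e
    unfolding marginal_def by (intro sum_mono) (simp add: T_def)
  moreover have "ereal R \<le> H_min T (marginal P)"
    by (subst H[OF T0]) (simp add: T_def)
  ultimately have "T \<in> ?A" by simp
  moreover have "l1_dist P T = ?d"
    unfolding l1_dist_def T_def by (intro sum.cong) (auto simp: max_def min_def)
  ultimately show ?thesis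
    using lb by (intro cInf_eq_minimum) (auto intro: rev_image_eqI)
qed

lemma \<Delta>_I_min_eq:
  fixes P :: "'a::finite \<times> 'e::finite \<Rightarrow> real"
  assumes "P \<in> sub_dists" and "P x0 \<noteq> 0"
  shows "\<Delta>_I_min M \<epsilon> P = (INF R::real.
    ereal (eta (\<Sum>x\<in>UNIV. max (P x - exp (- R) * marginal P (snd x)) 0) (ln (real M))
           + \<epsilon> * real M * exp (- R)))"
  unfolding \<Delta>_I_min_def truncation_dist[OF assms] ..

text \<open>For each \<open>R\<close> a suitable \<open>R'\<close> is found. The distance
  \<open>d\<close> lies between \<open>k * w R1\<close> and \<open>m\<close>, so
  \<open>eta d y\<close> dominates \<open>eta\<close> at one of these ends; the first end leads to
  \<open>R' = R1\<close>, the second to a large \<open>R'\<close>.\<close>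

lemma \<Delta>_I_min_ge:
  fixes P :: "'a::finite \<times> 'e::finite \<Rightarrow> real"
  assumes P: "P \<in> sub_dists" and nz: "P x0 \<noteq> 0" and M: "M > 0" and eps: "\<epsilon> > 0" and c: "c > 1"
  shows "ereal (1 - 1 / c) *
        (INF R'::real.
           ereal (eta (sum P {(a, e). cond P a e \<ge> c * exp (- R')}) (ln (real M))
                  + \<epsilon> * real M * exp (- R')))
      \<le> \<Delta>_I_min M \<epsilon> P"
  unfolding \<Delta>_I_min_eq[OF P nz]
proof (rule INF_greatest)
  fix R :: real
  define k where "k = 1 - 1 / c"
  define y where "y = ln (real M)"
  define m where "m = sum P UNIV"
  define d where "d = (\<Sum>x\<in>UNIV. max (P x - exp (- R) * marginal P (snd x)) 0)"
  define w where "w R' = sum P {(a, e). cond P a e \<ge> c * exp (- R')}" for R'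
  have k: "0 < k" "k < 1" using c by (auto simp: k_def)
  have y: "0 \<le> y" using M by (simp add: y_def)
  have P0: "\<And>x. 0 \<le> P x" using P by (rule sub_dists_nonneg)
  have m0: "0 \<le> marginal P e" for e unfolding marginal_def by (intro sum_nonneg) (simp add: P0)
  have "0 < P x0" using nz P0[of x0] by simp
  also have "\<dots> \<le> m" unfolding m_def by (rule member_le_sum) (use P0 in auto)
  finally have m: "0 < m" .
  have m1: "m \<le> 1" using P by (simp add: sub_dists_def m_def)
  have dm: "d \<le> m"
    unfolding d_def m_def using P0 m0 by (intro sum_mono) auto
  have "\<exists>R'. k * (eta (w R') y + \<epsilon> * real M * exp (- R')) \<le> eta d y + \<epsilon> * real M * exp (- R)"
  proof -
    \<comment> \<open>The shift by \<open>ln m\<close> translates a level relative to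
      \<open>marginal P\<close> into one for \<open>cond\<close>. As \<open>m \<le> 1\<close>, it
      can only decrease the exponential term.\<close>
    define R1 where "R1 = R - ln m"
    have eR1: "exp (- R1) = m * exp (- R)" using m by (simp add: R1_def exp_diff exp_minus field_simps)
    have "k * w R1 \<le> d"
    proof -
      have "w R1 = (\<Sum>x\<in>UNIV. if cond P (fst x) (snd x) \<ge> c * exp (- R1) then P x else 0)"
        unfolding w_def by (simp add: sum.If_cases case_prod_unfold)
      then have "k * w R1 = (\<Sum>x\<in>UNIV. k * (if cond P (fst x) (snd x) \<ge> c * exp (- R1) then P x else 0))"
        by (simp add: sum_distrib_left)
      also have "\<dots> \<le> d"
        unfolding d_def
      proof (rule sum_mono)
        fix x :: "'a \<times> 'e"
        let ?K = "exp (- R) * marginal P (snd x)"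
        have "k * P x \<le> P x - ?K" if "cond P (fst x) (snd x) \<ge> c * exp (- R1)"
        proof -
          have le: "c * (m * exp (- R)) \<le> P x * m / marginal P (snd x)"
            using that by (simp add: cond_eq eR1 m_def)
          have "0 < c * (m * exp (- R))" using c m by simp
          \<comment> \<open>Division by zero yields \<open>0\<close>, which would contradict the
            positive lower bound.\<close>
          then have "marginal P (snd x) \<noteq> 0" using le by auto
          then have "0 < marginal P (snd x)" using m0[of "snd x"] by simp
          then have "m * (c * ?K) \<le> m * P x" using le by (simp add: field_simps)
          then have "c * ?K \<le> P x" using m by simp
          then have "?K \<le> P x / c" using c by (simp add: field_simps)
          then show ?thesis by (simp add: k_def algebra_simps)
        qed
        then show "k * (if cond P (fst x) (snd x) \<ge> c * exp (- R1) then P x else 0) \<le> max (P x - ?K) 0"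
          by auto
      qed
      finally show ?thesis .
    qed
    moreover have w0: "0 \<le> w R'" for R' unfolding w_def by (intro sum_nonneg) (simp add: P0)
    ultimately consider "eta (k * w R1) y \<le> eta d y" | "eta m y \<le> eta d y"
      using eta_quasiconcave[of "k * w R1" d m y] k dm by fastforce
    then show ?thesis
    proof cases
      case 1
      have "k * eta (w R1) y \<le> eta d y" using eta_scale_ge[of "w R1" k y] w0[of R1] k 1 by linarith
      moreover have "k * exp (- R1) \<le> 1 * exp (- R)"
        unfolding eR1 mult.assoc[symmetric] using k m m1 by (intro mult_right_mono mult_le_one) auto
      then have "\<epsilon> * real M * (k * exp (- R1)) \<le> \<epsilon> * real M * (1 * exp (- R))"
        using eps by (intro mult_left_mono) auto
      ultimately show ?thesis by (intro exI[of _ R1]) (simp add: algebra_simps)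
    next
      case 2
      text \<open>For large \<open>R'\<close> the level set is the whole support of \<open>P\<close>.\<close>
      have "\<forall>\<^sub>F R' in at_top. c * exp (- R') \<le> P x * m / marginal P (snd x)" if "P x \<noteq> 0" for x
      proof -
        have "0 < P x" using that P0[of x] by simp
        moreover have "P x \<le> marginal P (snd x)" using le_marginal[of P "fst x" "snd x"] P0 by simp
        ultimately have "0 < P x * m / marginal P (snd x)" using m by simp
        moreover have "((\<lambda>R'. c * exp (- R')) \<longlongrightarrow> 0) at_top" by real_asymp
        ultimately have "\<forall>\<^sub>F R' in at_top. c * exp (- R') < P x * m / marginal P (snd x)"
          by (intro order_tendstoD)
        then show ?thesis by eventually_elim simp
      qed
      then have "\<forall>\<^sub>F R' in at_top. P x \<noteq> 0 \<longrightarrow> c * exp (- R') \<le> P x * m / marginal P (snd x)" for x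
        by (cases "P x = 0") auto
      then have "\<forall>\<^sub>F R' in at_top. \<forall>x. P x \<noteq> 0 \<longrightarrow> c * exp (- R') \<le> P x * m / marginal P (snd x)"
        by (rule eventually_all_finite)
      then have "\<forall>\<^sub>F R' in at_top. R \<le> R' \<and> (\<forall>x. P x \<noteq> 0 \<longrightarrow> c * exp (- R') \<le> P x * m / marginal P (snd x))"
        using eventually_ge_at_top eventually_conj by blast
      then obtain R' where R': "R \<le> R'" "\<And>x. P x \<noteq> 0 \<Longrightarrow> c * exp (- R') \<le> P x * m / marginal P (snd x)"
        by (auto dest!: eventually_happens)
      have "w R' = m"
        unfolding w_def m_def using R'(2) by (intro sum.mono_neutral_left) (auto simp: cond_eq m_def)
      moreover have "0 \<le> eta m y" using m m1 y by (intro eta_nonneg) auto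
      then have "k * eta m y \<le> eta m y" using k by (intro mult_left_le_one_le) auto
      moreover have "k * exp (- R') \<le> 1 * exp (- R)" using k R'(1) by (intro mult_mono) auto
      then have "\<epsilon> * real M * (k * exp (- R')) \<le> \<epsilon> * real M * (1 * exp (- R))"
        using eps by (intro mult_left_mono) auto
      ultimately show ?thesis using 2 by (intro exI[of _ R']) (simp add: algebra_simps)
    qed
  qed
  then obtain R' where R': "k * (eta (w R') y + \<epsilon> * real M * exp (- R')) \<le> eta d y + \<epsilon> * real M * exp (- R)"
    by blast
  have "ereal k * (INF R'. ereal (eta (w R') y + \<epsilon> * real M * exp (- R')))
      \<le> ereal k * ereal (eta (w R') y + \<epsilon> * real M * exp (- R'))"
    using k by (intro ereal_mult_left_mono INF_lower) auto
  also have "\<dots> \<le> ereal (eta d y + \<epsilon> * real M * exp (- R))" using R' by simp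
  finally show "ereal (1 - 1 / c) * (INF R'::real.
           ereal (eta (sum P {(a, e). cond P a e \<ge> c * exp (- R')}) (ln (real M))
                  + \<epsilon> * real M * exp (- R')))
    \<le> ereal (eta (\<Sum>x\<in>UNIV. max (P x - exp (- R) * marginal P (snd x)) 0) (ln (real M))
           + \<epsilon> * real M * exp (- R))"
    by (simp add: k_def y_def d_def w_def)
qed

text \<open>With \<open>K\<close> in place of \<open>exp (- R)\<close>, the optimal distance
  \<open>D K\<close> is continuous and \<open>D 0 = m\<close>. The mass \<open>w\<close> lies
  between \<open>D K\<close> and \<open>m\<close>, so some level \<open>L \<le> K\<close> has
  distance exactly \<open>w\<close>, and the remaining term is at most its value at
  \<open>K\<close>.\<close>

lemma \<Delta>_I_min_le:
  fixes P :: "'a::finite \<times> 'e::finite \<Rightarrow> real"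
  assumes P: "P \<in> sub_dists" and nz: "P x0 \<noteq> 0" and M: "M > 0" and eps: "\<epsilon> > 0"
  shows "\<Delta>_I_min M \<epsilon> P
      \<le> (INF R'::real.
           ereal (eta (sum P {(a, e). cond P a e > exp (- R')}) (ln (real M))
                  + \<epsilon> * real M * exp (- R') / sum P UNIV))"
proof (rule INF_greatest)
  fix R' :: real
  define y where "y = ln (real M)"
  define m where "m = sum P UNIV"
  define D where "D K = (\<Sum>x\<in>UNIV. max (P x - K * marginal P (snd x)) 0)" for K
  define w where "w = sum P {(a, e). cond P a e > exp (- R')}"
  have P0: "\<And>x. 0 \<le> P x" using P by (rule sub_dists_nonneg)
  have m0: "0 \<le> marginal P e" for e unfolding marginal_def by (intro sum_nonneg) (simp add: P0)
  have "0 < P x0" using nz P0[of x0] by simp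
  also have "\<dots> \<le> m" unfolding m_def by (rule member_le_sum) (use P0 in auto)
  finally have m: "0 < m" .
  have D0: "D 0 = m" unfolding D_def m_def using P0 by (intro sum.cong) auto
  have contD: "continuous_on S D" for S unfolding D_def by (intro continuous_intros)
  have DK: "\<Delta>_I_min M \<epsilon> P \<le> ereal (eta (D K) y + \<epsilon> * real M * K)" if "0 < K" for K
  proof -
    have "\<Delta>_I_min M \<epsilon> P \<le> ereal (eta (D (exp (- (- ln K)))) y + \<epsilon> * real M * exp (- (- ln K)))"
      unfolding \<Delta>_I_min_eq[OF P nz] D_def y_def by (rule INF_lower) simp
    then show ?thesis using that by simp
  qed
  \<comment> \<open>The level relative to \<open>marginal P\<close> that corresponds to
    \<open>exp (- R')\<close> for \<open>cond\<close>; this is the origin of the factor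
    \<open>1 / sum P UNIV\<close>.\<close>
  define K where "K = exp (- R') / m"
  have K: "0 < K" using m by (simp add: K_def)
  have "D K \<le> w"
  proof -
    have "max (P x - K * marginal P (snd x)) 0 \<le> (if cond P (fst x) (snd x) > exp (- R') then P x else 0)" for x
    proof (cases "cond P (fst x) (snd x) > exp (- R')")
      case True
      then show ?thesis using P0[of x] K m0[of "snd x"] by simp
    next
      case False
      have "P x \<le> K * marginal P (snd x)"
      proof (cases "marginal P (snd x) = 0")
        case True
        then show ?thesis using le_marginal[of P "fst x" "snd x"] P0 by simp
      next
        case mn: False
        then have "0 < marginal P (snd x)" using m0[of "snd x"] by simp
        moreover have "P x * m / marginal P (snd x) \<le> exp (- R')"
          using False by (simp add: cond_eq m_def)
        ultimately show ?thesis using m by (simp add: K_def field_simps)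
      qed
      then show ?thesis using False by simp
    qed
    then have "D K \<le> (\<Sum>x\<in>UNIV. if cond P (fst x) (snd x) > exp (- R') then P x else 0)"
      unfolding D_def by (intro sum_mono)
    also have "\<dots> = w"
      unfolding w_def by (simp add: sum.If_cases case_prod_unfold)
    finally show ?thesis .
  qed
  moreover have "w \<le> m" unfolding w_def m_def using P0 by (intro sum_mono2) auto
  text \<open>\<open>eta\<close> need not be increasing on \<open>[0, 1]\<close> when \<open>M \<le> 2\<close>, so \<open>D K \<le> w\<close> alone is not
    enough: lower the level until the distance is exactly \<open>w\<close>.\<close>
  ultimately obtain L where L: "0 \<le> L" "L \<le> K" "D L = w"
    using IVT2'[of D K w 0] contD K D0 by auto
  have "\<Delta>_I_min M \<epsilon> P \<le> ereal (eta w y + \<epsilon> * real M * L)"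
  proof (cases "L = 0")
    case False
    then show ?thesis using DK[of L] L by simp
  next
    \<comment> \<open>Level \<open>0\<close> is \<open>exp (- R)\<close> for no real
      \<open>R\<close>, so the bound is obtained as the limit of \<open>DK\<close> from the right.
      Continuity of \<open>eta\<close> along \<open>D\<close> at \<open>0\<close> uses
      \<open>D 0 = m > 0\<close>, which keeps the logarithm away from its singularity.\<close>
    case True
    have "isCont D 0" using contD[of UNIV] by (simp add: continuous_on_eq_continuous_at)
    then have "isCont (\<lambda>K. eta (D K) y + \<epsilon> * real M * K) 0"
      unfolding eta_def using D0 m by (intro continuous_intros) auto
    then have "((\<lambda>K. eta (D K) y + \<epsilon> * real M * K) \<longlongrightarrow> eta (D 0) y + \<epsilon> * real M * 0) (at_right 0)"
      unfolding isCont_def by (rule filterlim_mono[OF _ order_refl]) (simp add: at_le)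
    then have "((\<lambda>K. ereal (eta (D K) y + \<epsilon> * real M * K)) \<longlongrightarrow> ereal (eta (D 0) y + \<epsilon> * real M * 0)) (at_right 0)"
      by (rule tendsto_ereal)
    then have "\<Delta>_I_min M \<epsilon> P \<le> ereal (eta (D 0) y + \<epsilon> * real M * 0)"
      by (rule tendsto_lowerbound)
        (auto simp: eventually_at_filter intro!: always_eventually DK)
    then show ?thesis using True L by simp
  qed
  also have "\<dots> \<le> ereal (eta w y + \<epsilon> * real M * K)"
    using L eps by (auto intro!: mult_left_mono)
  finally show "\<Delta>_I_min M \<epsilon> P \<le> ereal (eta (sum P {(a, e). cond P a e > exp (- R')}) (ln (real M))
                  + \<epsilon> * real M * exp (- R') / sum P UNIV)"
    by (simp add: w_def y_def K_def m_def)
qed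

theorem theorem20:
  fixes P :: "'a::finite \<times> 'e::finite \<Rightarrow> real" and M :: nat and \<epsilon> c :: real
  assumes "P \<in> sub_dists" and "\<exists>x. P x \<noteq> 0"
    and "M > 0" and "\<epsilon> > 0" and "c > 1"
  shows
    "(ereal (2 * (1 - 1 / c)) *
        (INF Q\<in>prob_dists. INF R'::real.
           ereal (sum P {(a, e). P (a, e) > c * exp (- R') * Q e}
                  + sqrt \<epsilon> * sqrt (real M) * exp (- (1/2) * R')))
      \<le> \<Delta>_d_min M \<epsilon> P)
   \<and> (\<Delta>_d_min M \<epsilon> P
      \<le> (INF Q\<in>prob_dists. INF R'::real.
           ereal (2 * sum P {(a, e). P (a, e) > exp (- R') * Q e}
                  + sqrt \<epsilon> * sqrt (real M) * exp (- (1/2) * R'))))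
   \<and> (ereal (1 - 1 / c) *
        (INF R'::real.
           ereal (eta (sum P {(a, e). cond P a e \<ge> c * exp (- R')}) (ln (real M))
                  + \<epsilon> * real M * exp (- R')))
      \<le> \<Delta>_I_min M \<epsilon> P)
   \<and> (\<Delta>_I_min M \<epsilon> P
      \<le> (INF R'::real.
           ereal (eta (sum P {(a, e). cond P a e > exp (- R')}) (ln (real M))
                  + \<epsilon> * real M * exp (- R') / sum P UNIV)))"
proof -
  obtain x0 where "P x0 \<noteq> 0" using assms by blast
  moreover have "0 < sqrt \<epsilon> * sqrt (real M)" using assms by simp
  ultimately show ?thesis
    using assms by (intro conjI \<Delta>_d_min_ge \<Delta>_d_min_le \<Delta>_I_min_ge \<Delta>_I_min_le) auto
qed

end
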